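(* Let $\mathfrak{g}$ be a finite-dimensional real solvable Lie algebra equipped with an invariant scalar product $\langle\cdot,\cdot\rangle$ which is Einstein, and let $s$ be the Witt index of $\langle\cdot,\cdot\rangle$. Let $\mathfrak{n}$ be the nilradical of $\mathfrak{g}$. If $\mathfrak{g}$ is not nilpotent, then $\dim\mathfrak{g}\geq 6$, $\dim\mathfrak{n}\geq 5$ and $s\geq 2$.
   Context: A scalar product on $\mathfrak{g}$ is a non-degenerate symmetric bilinear form; it is invariant if $\langle [x,y_1],y_2\rangle=-\langle y_1,[x,y_2]\rangle$ for all $x,y_1,y_2\in\mathfrak{g}$. The Witt index is the maximal dimension of a totally isotropic subspace (a subspace $\mathfrak{v}$ with $\mathfrak{v}\subset\mathfrak{v}^\perp$). The invariant scalar product is called Einstein if the bi-invariant pseudo-Riemannian metric on a connected Lie group with Lie algebra $\mathfrak{g}$ obtained by left translation of $\langle\cdot,\cdot\rangle$ is an Einstein metric ($\mathrm{Ric}=\lambda\,\mathtt{g}$ for a constant $\lambda$); for solvable $\mathfrak{g}$ this is equivalent to the vanishing of the Killing form $\kappa(x,y)=\mathrm{tr}(\mathrm{ad}(x)\mathrm{ad}(y))$. *)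

theory Defs
  imports "HOL-Analysis.Analysis"
begin

text \<open>A finite-dimensional real Lie algebra is modelled as a type of class euclidean_space
  (a finite-dimensional real vector space; its built-in inner product is only used to
  compute traces, which are basis independent) together with a bracket br.\<close>

definition lie_algebra :: "('a::euclidean_space \<Rightarrow> 'a \<Rightarrow> 'a) \<Rightarrow> bool" where
  "lie_algebra br \<longleftrightarrow> bilinear br \<and> (\<forall>x. br x x = 0) \<and>
     (\<forall>x y z. br x (br y z) + br y (br z x) + br z (br x y) = 0)"

fun derived_series :: "('a::euclidean_space \<Rightarrow> 'a \<Rightarrow> 'a) \<Rightarrow> nat \<Rightarrow> 'a set" where
  "derived_series br 0 = UNIV"
| "derived_series br (Suc k) =
     span {br x y | x y. x \<in> derived_series br k \<and> y \<in> derived_series br k}"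

definition solvable_lie :: "('a::euclidean_space \<Rightarrow> 'a \<Rightarrow> 'a) \<Rightarrow> bool" where
  "solvable_lie br \<longleftrightarrow> (\<exists>k. derived_series br k = {0})"

fun lower_central :: "('a::euclidean_space \<Rightarrow> 'a \<Rightarrow> 'a) \<Rightarrow> 'a set \<Rightarrow> nat \<Rightarrow> 'a set" where
  "lower_central br h 0 = h"
| "lower_central br h (Suc k) = span {br x y | x y. x \<in> h \<and> y \<in> lower_central br h k}"

definition nilpotent_sub :: "('a::euclidean_space \<Rightarrow> 'a \<Rightarrow> 'a) \<Rightarrow> 'a set \<Rightarrow> bool" where
  "nilpotent_sub br h \<longleftrightarrow> (\<exists>k. lower_central br h k = {0})"

definition nilpotent_lie :: "('a::euclidean_space \<Rightarrow> 'a \<Rightarrow> 'a) \<Rightarrow> bool" where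
  "nilpotent_lie br \<longleftrightarrow> nilpotent_sub br UNIV"

definition lie_ideal :: "('a::euclidean_space \<Rightarrow> 'a \<Rightarrow> 'a) \<Rightarrow> 'a set \<Rightarrow> bool" where
  "lie_ideal br I \<longleftrightarrow> subspace I \<and> (\<forall>x y. y \<in> I \<longrightarrow> br x y \<in> I)"

definition nilradical :: "('a::euclidean_space \<Rightarrow> 'a \<Rightarrow> 'a) \<Rightarrow> 'a set" where
  "nilradical br = span (\<Union>{I. lie_ideal br I \<and> nilpotent_sub br I})"

definition scalar_product :: "('a::euclidean_space \<Rightarrow> 'a \<Rightarrow> real) \<Rightarrow> bool" where
  "scalar_product sp \<longleftrightarrow> bilinear sp \<and> (\<forall>x y. sp x y = sp y x) \<and>
     (\<forall>x. (\<forall>y. sp x y = 0) \<longrightarrow> x = 0)"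

definition invariant_sp :: "('a::euclidean_space \<Rightarrow> 'a \<Rightarrow> 'a) \<Rightarrow> ('a \<Rightarrow> 'a \<Rightarrow> real) \<Rightarrow> bool" where
  "invariant_sp br sp \<longleftrightarrow> scalar_product sp \<and>
     (\<forall>x y1 y2. sp (br x y1) y2 = - sp y1 (br x y2))"

definition totally_isotropic :: "('a::euclidean_space \<Rightarrow> 'a \<Rightarrow> real) \<Rightarrow> 'a set \<Rightarrow> bool" where
  "totally_isotropic sp V \<longleftrightarrow> subspace V \<and> (\<forall>x\<in>V. \<forall>y\<in>V. sp x y = 0)"

definition witt_index :: "('a::euclidean_space \<Rightarrow> 'a \<Rightarrow> real) \<Rightarrow> nat" where
  "witt_index sp = Max {dim V | V. totally_isotropic sp V}"

definition trace_map :: "('a::euclidean_space \<Rightarrow> 'a) \<Rightarrow> real" where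
  "trace_map f = (\<Sum>b\<in>Basis. f b \<bullet> b)"

text \<open>Left-invariant pseudo-Riemannian geometry of the metric obtained by left translation of sp:
  Levi-Civita connection on left-invariant vector fields via the Koszul formula
  2<nabla_x y, z> = <[x,y],z> - <[y,z],x> + <[z,x],y>, curvature
  R(x,y)z = nabla_x nabla_y z - nabla_y nabla_x z - nabla_[x,y] z, and Ricci tensor
  Ric(y,z) = tr(x |-> R(x,y)z).\<close>
definition lc_conn :: "('a::euclidean_space \<Rightarrow> 'a \<Rightarrow> 'a) \<Rightarrow> ('a \<Rightarrow> 'a \<Rightarrow> real) \<Rightarrow> 'a \<Rightarrow> 'a \<Rightarrow> 'a" where
  "lc_conn br sp x y = (THE w. \<forall>z. 2 * sp w z = sp (br x y) z - sp (br y z) x + sp (br z x) y)"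

definition curvature :: "('a::euclidean_space \<Rightarrow> 'a \<Rightarrow> 'a) \<Rightarrow> ('a \<Rightarrow> 'a \<Rightarrow> real) \<Rightarrow> 'a \<Rightarrow> 'a \<Rightarrow> 'a \<Rightarrow> 'a" where
  "curvature br sp x y z =
     lc_conn br sp x (lc_conn br sp y z) - lc_conn br sp y (lc_conn br sp x z)
     - lc_conn br sp (br x y) z"

definition ricci :: "('a::euclidean_space \<Rightarrow> 'a \<Rightarrow> 'a) \<Rightarrow> ('a \<Rightarrow> 'a \<Rightarrow> real) \<Rightarrow> 'a \<Rightarrow> 'a \<Rightarrow> real" where
  "ricci br sp y z = trace_map (\<lambda>x. curvature br sp x y z)"

definition einstein :: "('a::euclidean_space \<Rightarrow> 'a \<Rightarrow> 'a) \<Rightarrow> ('a \<Rightarrow> 'a \<Rightarrow> real) \<Rightarrow> bool" where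
  "einstein br sp \<longleftrightarrow> (\<exists>c::real. \<forall>y z. ricci br sp y z = c * sp y z)"

end

theory Submission
  imports Defs
begin

text \<open>For a bi-invariant metric the Levi-Civita connection is half the bracket, so the Ricci form
  is \<open>-1/4\<close> times the Killing form. A solvable non-nilpotent metric Lie algebra has a nonzero central
  element \<open>e\<close> in the derived algebra: otherwise the derived algebra would be non-degenerate with
  central orthogonal complement, hence perfect. Testing the Einstein condition on \<open>e\<close> makes the
  Killing form vanish.

  By Engel's theorem some \<open>f = ad x\<close> is not nilpotent. Let \<open>V\<close> be its Fitting one-component, on
  which \<open>f\<close> is an invertible skew operator with \<open>tr f\<^sup>2 = 0\<close>. In a pseudo-orthonormal basis of \<open>V\<close>
  with signs \<open>\<epsilon>\<^sub>i\<close> the trace condition is \<open>\<Sum> \<epsilon>\<^sub>i \<epsilon>\<^sub>j A\<^sub>i\<^sub>j\<^sup>2 = 0\<close> for a skew matrix \<open>A\<close> of full rank; so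
  the signs are mixed, which gives an isotropic \<open>v\<close> in \<open>V\<close>, and \<open>dim V \<ge> 4\<close>. Now \<open>V + \<real>e\<close> lies in
  the derived algebra, which is a nilpotent ideal, \<open>x\<close> lies outside \<open>V + \<real>e\<close>, and \<open>v\<close>, \<open>e\<close> span a
  totally isotropic plane.

  Nilpotency of the derived algebra and Engel's theorem both follow by refining a chain of ideals:
  between neighbouring ideals the derived algebra acts by commuting operators that are nilpotent by
  a trace argument, hence by zero.\<close>

section \<open>Traces and Fitting decomposition\<close>

lemma trace_map_commute:
  fixes f g :: "'a::euclidean_space \<Rightarrow> 'a"
  assumes "linear f" "linear g"
  shows "trace_map (\<lambda>x. f (g x)) = trace_map (\<lambda>x. g (f x))"
proof -
  have exp: "h (k b) \<bullet> b = (\<Sum>c\<in>Basis. (k b \<bullet> c) * (h c \<bullet> b))" if "linear h" for h k and b::'a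
  proof -
    have "h (k b) = h (\<Sum>c\<in>Basis. (k b \<bullet> c) *\<^sub>R c)" by (simp add: euclidean_representation)
    also have "\<dots> = (\<Sum>c\<in>Basis. (k b \<bullet> c) *\<^sub>R h c)"
      using that by (simp add: linear_sum linear_scale)
    finally show ?thesis by (simp add: inner_sum_left)
  qed
  have "trace_map (\<lambda>x. f (g x)) = (\<Sum>b\<in>Basis. \<Sum>c\<in>Basis. (g b \<bullet> c) * (f c \<bullet> b))"
    by (simp add: trace_map_def exp assms)
  also have "\<dots> = (\<Sum>c\<in>Basis. \<Sum>b\<in>Basis. (g b \<bullet> c) * (f c \<bullet> b))" by (rule sum.swap)
  also have "\<dots> = trace_map (\<lambda>x. g (f x))"
    unfolding trace_map_def by (simp add: exp[OF assms(2)] mult.commute)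
  finally show ?thesis .
qed

lemma trace_map_rank_one:
  fixes \<phi> :: "'a::euclidean_space \<Rightarrow> real"
  assumes "linear \<phi>"
  shows "trace_map (\<lambda>x. \<phi> x *\<^sub>R w) = \<phi> w"
proof -
  have "\<phi> w = \<phi> (\<Sum>b\<in>Basis. (w \<bullet> b) *\<^sub>R b)" by (simp add: euclidean_representation)
  also have "\<dots> = (\<Sum>b\<in>Basis. (w \<bullet> b) * \<phi> b)" using assms by (simp add: linear_sum linear_scale)
  finally show ?thesis by (simp add: trace_map_def mult.commute)
qed

lemma trace_map_add: "trace_map (\<lambda>x. f x + g x) = trace_map f + trace_map g"
  by (simp add: trace_map_def inner_add_left sum.distrib)

lemma trace_map_diff: "trace_map (\<lambda>x. f x - g x) = trace_map f - trace_map g"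
  by (simp add: trace_map_def inner_diff_left sum_subtractf)

lemma trace_map_scaleR: "trace_map (\<lambda>x. c *\<^sub>R f x) = c * trace_map f"
  by (simp add: trace_map_def sum_distrib_left)

lemma trace_map_zero: "trace_map (\<lambda>x. 0) = 0"
  by (simp add: trace_map_def)

lemma trace_map_sum: "trace_map (\<lambda>x. \<Sum>i\<in>I. f i x) = (\<Sum>i\<in>I. trace_map (f i))"
  unfolding trace_map_def inner_sum_left by (rule sum.swap)

section \<open>Traces of projections and nilpotent maps; the Fitting one-component\<close>

lemma projection_exists:
  fixes S :: "'a::euclidean_space set"
  assumes "subspace S"
  obtains P where "linear P" "\<And>x. P x \<in> S" "\<And>x. x \<in> S \<Longrightarrow> P x = x"
  using linear_exists_left_inverse_on[of id S] assms by (auto simp: linear_id)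

text \<open>Coordinates with respect to a basis of \<open>S\<close> write \<open>E\<close> as a sum
  of rank-one maps; each has trace 1, since \<open>E\<close> fixes the basis vectors.\<close>

lemma trace_map_projection:
  fixes E :: "'a::euclidean_space \<Rightarrow> 'a"
  assumes "linear E" and S: "subspace S" and ran: "\<And>x. E x \<in> S" and id: "\<And>x. x \<in> S \<Longrightarrow> E x = x"
  shows "trace_map E = real (dim S)"
proof -
  obtain B where B: "B \<subseteq> S" "independent B" "S \<subseteq> span B" "card B = dim S"
    using basis_exists by blast
  have sB: "span B = S" using B S by (metis span_minimal subset_antisym)
  have fin: "finite B" using B(2) by (rule independent_imp_finite)
  have lin: "linear (\<lambda>x. representation B (E x) b)" for b
    by (rule linearI)
      (use assms ran in \<open>auto simp: sB B(2) linear_add linear_scale representation_add representation_scale\<close>)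
  have "E = (\<lambda>x. \<Sum>b\<in>B. representation B (E x) b *\<^sub>R b)"
    using sum_representation_eq[OF B(2) _ fin order_refl] ran sB by fastforce
  then have "trace_map E = trace_map (\<lambda>x. \<Sum>b\<in>B. representation B (E x) b *\<^sub>R b)" by simp
  also have "\<dots> = (\<Sum>b\<in>B. representation B (E b) b)"
    by (simp add: trace_map_sum trace_map_rank_one lin)
  also have "\<dots> = (\<Sum>b\<in>B. 1)"
    by (rule sum.cong) (use B id in \<open>auto simp: representation_basis\<close>)
  finally show ?thesis by (simp add: B(4))
qed

lemma linear_funpow:
  fixes f :: "'a::real_vector \<Rightarrow> 'a"
  assumes "linear f"
  shows "linear (f ^^ n)"
proof (induction n)
  case 0
  then show ?case by (simp add: linear_id[unfolded id_def] id_def)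
next
  case (Suc n)
  then show ?case using linear_compose[of "f ^^ n" f] assms by (simp add: o_def)
qed

lemma funpow_closed: "(\<And>x. x \<in> S \<Longrightarrow> f x \<in> S) \<Longrightarrow> x \<in> S \<Longrightarrow> (f ^^ n) x \<in> S"
  by (induction n) auto

text \<open>Induction on the exponent. With \<open>P\<close> a projection onto the range of
  \<open>h\<close>, the maps \<open>h = P h\<close> and \<open>h P\<close> have the same trace, and
  \<open>h P\<close> has a smaller exponent because \<open>P\<close> already lands in the range of
  \<open>h\<close>.\<close>

lemma trace_map_nilpotent:
  fixes h :: "'a::euclidean_space \<Rightarrow> 'a"
  assumes "linear h" and "\<And>x. (h ^^ m) x = 0"
  shows "trace_map h = 0"
  using assms
proof (induction m arbitrary: h)
  case 0
  then have "h = (\<lambda>x. 0)" by (metis funpow_0 linear_0 ext)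
  then show ?case by (simp add: trace_map_zero)
next
  case (Suc m)
  obtain P where P: "linear P" "\<And>x. P x \<in> range h" "\<And>x. x \<in> range h \<Longrightarrow> P x = x"
    using projection_exists[of "range h"] linear_subspace_image[OF Suc.prems(1) subspace_UNIV] by metis
  have *: "((\<lambda>x. h (P x)) ^^ k) x = (h ^^ k) (P x)" if "k > 0" for k x
    using that
  proof (induction k)
    case (Suc k)
    then show ?case
      by (cases k) (auto simp: P(3))
  qed simp
  have lin: "linear (\<lambda>x. h (P x))" using linear_compose[OF P(1) Suc.prems(1)] by (simp add: o_def)
  have "trace_map h = trace_map (\<lambda>x. P (h x))" by (simp add: P)
  also have "\<dots> = trace_map (\<lambda>x. h (P x))" by (rule trace_map_commute) (use P Suc.prems in auto)
  also have "\<dots> = 0"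
  proof (cases "m = 0")
    case True
    then show ?thesis using Suc.prems by (simp add: trace_map_zero)
  next
    case False
    show ?thesis
    proof (rule Suc.IH[OF lin])
      fix x
      obtain y where "P x = h y" using P(2) by blast
      then show "((\<lambda>x. h (P x)) ^^ m) x = 0"
        using False Suc.prems(2)[of y] by (simp add: * funpow_swap1)
    qed
  qed
  finally show ?case .
qed

text \<open>Among the images of positive powers of \<open>f\<close> one has least dimension;
  \<open>f\<close> maps it onto itself, hence bijectively. The exponent is kept positive so that
  this image lies in the range of \<open>f\<close>.\<close>

lemma fitting_decomposition:
  fixes f :: "'a::euclidean_space \<Rightarrow> 'a"
  assumes f: "linear f"
  obtains n g where "n > 0" "linear g"
    "\<forall>v\<in>range (f ^^ n). f v \<in> range (f ^^ n) \<and> g v \<in> range (f ^^ n) \<and> g (f v) = v \<and> f (g v) = v"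
proof -
  obtain n where n: "n > 0" "\<And>m. m > 0 \<Longrightarrow> dim (range (f ^^ n)) \<le> dim (range (f ^^ m))"
    using ex_has_least_nat[of "\<lambda>n. n > 0" 1 "\<lambda>n. dim (range (f ^^ n))"] by auto
  let ?V = "range (f ^^ n)"
  have sub: "subspace (range (f ^^ m))" for m
    using linear_subspace_image[OF linear_funpow[OF f] subspace_UNIV] .
  have cl: "f v \<in> ?V" if "v \<in> ?V" for v
    using that by (auto simp: funpow_swap1)
  have "f ` ?V = range (f ^^ Suc n)" by (auto simp: image_def)
  moreover have "range (f ^^ Suc n) = ?V"
    by (rule subspace_dim_equal) (use sub[of n] sub[of "Suc n"] n(2)[of "Suc n"] cl in auto)
  ultimately have im: "f ` ?V = ?V" by simp
  have inj: "inj_on f ?V"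
  proof -
    obtain P where P: "linear P" "\<And>x. P x \<in> ?V" "\<And>x. x \<in> ?V \<Longrightarrow> P x = x"
      using projection_exists[OF sub] by metis
    \<comment> \<open>Extending \<open>f\<close> by the identity on the kernel of \<open>P\<close>
      gives an endomorphism of the whole space, for which surjectivity implies injectivity.\<close>
    define F where "F = (\<lambda>x. f (P x) + (x - P x))"
    have "linear F" unfolding F_def
      by (rule linearI) (auto simp: linear_add linear_scale P(1) f algebra_simps)
    moreover have "surj F"
      unfolding surj_def
    proof
      fix y
      obtain v where v: "v \<in> ?V" "P y = f v" using im P(2) by (metis imageE)
      have "P (v + (y - P y)) = v" using P(3)[OF v(1)] P(3)[OF P(2)]
        by (simp add: linear_add[OF P(1)] linear_diff[OF P(1)])
      then show "\<exists>x. y = F x"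
        by (intro exI[of _ "v + (y - P y)"]) (simp add: F_def v(2))
    qed
    ultimately have "inj F" using linear_surj_imp_inj by blast
    moreover have "F v = f v" if "v \<in> ?V" for v using P(3)[OF that] by (simp add: F_def)
    ultimately show ?thesis by (metis inj_onI injD)
  qed
  obtain g where g: "range g \<subseteq> ?V" "linear g" "\<And>v. v \<in> ?V \<Longrightarrow> g (f v) = v"
    using linear_exists_left_inverse_on[OF f sub inj] by blast
  show thesis
  proof (rule that[OF n(1) g(2)], rule ballI)
    fix v assume v: "v \<in> ?V"
    then obtain u where "u \<in> ?V" "v = f u" using im by blast
    then have "f (g v) = v" using g(3) by simp
    then show "f v \<in> ?V \<and> g v \<in> ?V \<and> g (f v) = v \<and> f (g v) = v"
      using cl[OF v] g v by blast
  qed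
qed

text \<open>The operator \<open>s\<close> to test with is the Drazin inverse of \<open>c\<close>: the product \<open>c s\<close> is the
  projection to the Fitting one-component, whose trace is the dimension of that component.\<close>

lemma nilpotent_if_trace_bicommutant:
  fixes c :: "'a::euclidean_space \<Rightarrow> 'a"
  assumes c: "linear c"
    and tr: "\<And>s. linear s \<Longrightarrow> (\<And>y. linear y \<Longrightarrow> (\<And>x. y (c x) = c (y x)) \<Longrightarrow> (\<And>x. y (s x) = s (y x)))
               \<Longrightarrow> trace_map (\<lambda>x. c (s x)) = 0"
  obtains n where "n > 0" "\<And>x. (c ^^ n) x = 0"
proof -
  obtain n g where n: "n > 0" and g: "linear g"
    and fit: "\<forall>v\<in>range (c ^^ n). c v \<in> range (c ^^ n) \<and> g v \<in> range (c ^^ n) \<and> g (c v) = v \<and> c (g v) = v"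
    by (rule fitting_decomposition[OF c])
  define V where "V = range (c ^^ n)"
  have V: "c v \<in> V" "g v \<in> V" "g (c v) = v" "c (g v) = v" if "v \<in> V" for v
    using fit that unfolding V_def by blast+
  \<comment> \<open>\<open>g\<close> inverts \<open>c\<close> only on \<open>V\<close>, so
    \<open>c ^^ n\<close> first moves the argument there; the one extra factor \<open>g\<close>
    cancels the \<open>c\<close> in \<open>c s\<close>.\<close>
  define s where "s = (\<lambda>x. (g ^^ Suc n) ((c ^^ n) x))"
  have linc: "linear (c ^^ k)" and ling: "linear (g ^^ k)" for k
    using linear_funpow c g by auto
  have lins: "linear s" unfolding s_def
    using linear_compose[OF linc[of n] ling[of "Suc n"]] by (simp add: o_def)
  have gV: "(g ^^ k) v \<in> V" if "v \<in> V" for k v using funpow_closed[of V g] V that by auto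
  have gc: "(g ^^ k) ((c ^^ k) v) = v" if "v \<in> V" for k v
    using that
  proof (induction k arbitrary: v)
    case (Suc k)
    have "(g ^^ Suc k) ((c ^^ Suc k) v) = g ((g ^^ k) ((c ^^ k) (c v)))" by (simp add: funpow_swap1)
    then show ?case using Suc V by simp
  qed simp
  have "trace_map (\<lambda>x. c (s x)) = 0"
  proof (rule tr[OF lins])
    fix y x assume y: "linear y" and yc: "\<And>x. y (c x) = c (y x)"
    have yck: "y ((c ^^ k) x) = (c ^^ k) (y x)" for k x by (induction k) (auto simp: yc)
    have yV: "y v \<in> V" if "v \<in> V" for v using that by (auto simp: V_def yck)
    have yg: "y (g v) = g (y v)" if "v \<in> V" for v
      using V(3)[OF yV[OF V(2)[OF that]]] V(4)[OF that] by (simp flip: yc)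
    have ygk: "y ((g ^^ k) v) = (g ^^ k) (y v)" if "v \<in> V" for v k
      using that by (induction k) (auto simp: yg gV)
    show "y (s x) = s (y x)" using ygk[of "(c ^^ n) x" "Suc n"] by (simp add: s_def V_def yck del: funpow.simps)
  qed
  moreover have "trace_map (\<lambda>x. c (s x)) = real (dim V)"
  proof (rule trace_map_projection)
    have cs: "c (s x) = (g ^^ n) ((c ^^ n) x)" for x
      using V(4) gV unfolding s_def by (simp add: V_def)
    show "linear (\<lambda>x. c (s x))" using linear_compose[OF lins c] by (simp add: o_def)
    show "subspace V" unfolding V_def by (rule linear_subspace_image[OF linc subspace_UNIV])
    show "c (s x) \<in> V" for x using cs gV by (simp add: V_def)
    show "c (s x) = x" if "x \<in> V" for x using cs gc that by simp
  qed
  ultimately have "dim V = 0" by simp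
  then have "V \<subseteq> {0}" by simp
  then show thesis using n that unfolding V_def by blast
qed

section \<open>Minimal ideals of a solvable Lie algebra\<close>

lemma exists_minimal_dim:
  assumes "Q (A :: 'a::euclidean_space set)"
  obtains M where "Q M" "\<And>M'. Q M' \<Longrightarrow> dim M \<le> dim M'"
  using ex_has_least_nat[of Q A dim] assms by blast

lemma dim_less_psubspace:
  fixes A B :: "'a::euclidean_space set"
  assumes "subspace A" "subspace B" "A \<subset> B"
  shows "dim A < dim B"
  using assms by (metis dim_psubset span_eq_iff)

text \<open>Take \<open>M\<close> minimal among the \<open>S\<close>-stable subspaces of
  \<open>W\<close> properly containing \<open>U\<close>. If some \<open>s\<close> did not map
  \<open>M\<close> into \<open>U\<close>, then \<open>s M + U\<close>, stable by commutation modulo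
  \<open>U\<close>, would equal \<open>M\<close>; iterating contradicts the nilpotency of
  \<open>s\<close>.\<close>

lemma commuting_nilpotents_common_kernel:
  fixes U W :: "'a::euclidean_space set"
  assumes U: "subspace U" and W: "subspace W" and UW: "U \<subset> W"
    and lin: "\<And>s. s \<in> S \<Longrightarrow> linear s"
    and sW: "\<And>s w. s \<in> S \<Longrightarrow> w \<in> W \<Longrightarrow> s w \<in> W"
    and sU: "\<And>s w. s \<in> S \<Longrightarrow> w \<in> U \<Longrightarrow> s w \<in> U"
    and comm: "\<And>s t w. s \<in> S \<Longrightarrow> t \<in> S \<Longrightarrow> w \<in> W \<Longrightarrow> s (t w) - t (s w) \<in> U"
    and nil: "\<And>s. s \<in> S \<Longrightarrow> \<exists>n. \<forall>w\<in>W. (s ^^ n) w \<in> U"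
  obtains w where "w \<in> W" "w \<notin> U" "\<And>s. s \<in> S \<Longrightarrow> s w \<in> U"
proof -
  define Q where "Q = (\<lambda>M. subspace M \<and> U \<subset> M \<and> M \<subseteq> W \<and> (\<forall>s\<in>S. \<forall>m\<in>M. s m \<in> M))"
  have "Q W" using W UW sW by (auto simp: Q_def)
  then obtain M where M: "Q M" and min: "\<And>M'. Q M' \<Longrightarrow> dim M \<le> dim M'"
    using exists_minimal_dim by blast
  have "s m \<in> U" if s: "s \<in> S" and "m \<in> M" for s m
  proof (rule ccontr)
    assume sm: "s m \<notin> U"
    define M' where "M' = {a + u |a u. a \<in> s ` M \<and> u \<in> U}"
    have sub: "subspace M'" unfolding M'_def
      by (intro subspace_sums linear_subspace_image lin s U) (use M in \<open>simp add: Q_def\<close>)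
    have M'M: "M' \<subseteq> M" using M s subspace_add by (fastforce simp: M'_def Q_def)
    have "U \<subseteq> M'"
    proof
      fix u assume "u \<in> U"
      moreover have "s 0 = 0" "0 \<in> M" using lin[OF s] M by (auto simp: linear_0 Q_def subspace_0)
      ultimately show "u \<in> M'" unfolding M'_def by (force intro: image_eqI[of _ s 0])
    qed
    moreover have "s m \<in> M'" using \<open>m \<in> M\<close> subspace_0[OF U] by (force simp: M'_def)
    ultimately have "U \<subset> M'" using sm by blast
    moreover have "t x \<in> M'" if t: "t \<in> S" and "x \<in> M'" for t x
    proof -
      obtain a u where a: "a \<in> M" "u \<in> U" "x = s a + u" using \<open>x \<in> M'\<close> by (auto simp: M'_def)
      have "t x = s (t a) + ((t (s a) - s (t a)) + t u)"
        using lin[OF t] by (simp add: a linear_add)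
      moreover have "t a \<in> M" using M t a by (auto simp: Q_def)
      moreover have "(t (s a) - s (t a)) + t u \<in> U"
        using comm[OF t s] sU[OF t] a M U by (auto simp: Q_def intro: subspace_add)
      ultimately show ?thesis unfolding M'_def by blast
    qed
    ultimately have "Q M'" using sub M M'M by (auto simp: Q_def)
    then have "M' = M" using min subspace_dim_equal[OF sub _ M'M] M by (auto simp: Q_def)
    have "\<exists>m'\<in>M. m - (s ^^ k) m' \<in> U" if "m \<in> M" for k m
    proof (induction k)
      case 0
      then show ?case using that subspace_0[OF U] by force
    next
      case (Suc k)
      then obtain m' where m': "m' \<in> M" "m - (s ^^ k) m' \<in> U" by blast
      then obtain a u where a: "a \<in> M" "u \<in> U" "m' = s a + u"
        using \<open>M' = M\<close> unfolding M'_def by blast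
      have "(s ^^ k) u \<in> U" using funpow_closed[of U s] sU s a by blast
      moreover have "m - (s ^^ Suc k) a = (m - (s ^^ k) m') + (s ^^ k) u"
        using linear_funpow[OF lin[OF s]] by (simp add: a linear_add funpow_swap1)
      ultimately show ?case using m' a subspace_add[OF U] by metis
    qed
    moreover obtain n where "\<forall>w\<in>W. (s ^^ n) w \<in> U" using nil[OF s] by blast
    ultimately have "m \<in> U" if m: "m \<in> M" for m
    proof -
      obtain m' where "m' \<in> M" and m': "m - (s ^^ n) m' \<in> U"
        using \<open>\<And>m k. m \<in> M \<Longrightarrow> \<exists>m'\<in>M. m - (s ^^ k) m' \<in> U\<close>[OF m] by blast
      then have "(s ^^ n) m' \<in> U" using M \<open>\<forall>w\<in>W. (s ^^ n) w \<in> U\<close> by (auto simp: Q_def)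
      then show ?thesis using subspace_add[OF U m', of "(s ^^ n) m'"] by simp
    qed
    then show False using M by (auto simp: Q_def)
  qed
  moreover obtain w where "w \<in> M" "w \<notin> U" using M by (auto simp: Q_def)
  moreover have "M \<subseteq> W" using M by (simp add: Q_def)
  ultimately show thesis using that by blast
qed


section \<open>Brackets, ideals and their action on quotients of ideals\<close>

locale lie =
  fixes br :: "'a::euclidean_space \<Rightarrow> 'a \<Rightarrow> 'a"
  assumes lie_algebra: "lie_algebra br"
begin

lemma bilinear_br: "bilinear br" and br_self [simp]: "br x x = 0"
  and br_cyclic: "br x (br y z) + br y (br z x) + br z (br x y) = 0"
  using lie_algebra by (auto simp: lie_algebra_def)

lemmas br_simps = bilinear_ladd[OF bilinear_br] bilinear_radd[OF bilinear_br]
  bilinear_lmul[OF bilinear_br] bilinear_rmul[OF bilinear_br]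
  bilinear_lsub[OF bilinear_br] bilinear_rsub[OF bilinear_br]
  bilinear_lzero[OF bilinear_br] bilinear_rzero[OF bilinear_br]
  bilinear_lneg[OF bilinear_br] bilinear_rneg[OF bilinear_br]

lemma linear_br: "linear (br x)"
  using bilinear_br by (simp add: bilinear_def)

lemma br_anti: "br y x = - br x y"
proof -
  have "br (x + y) (x + y) = 0" by (rule br_self)
  then show ?thesis by (simp add: br_simps eq_neg_iff_add_eq_0 add.commute del: br_self) (simp add: add.commute)
qed

lemma br_derivation: "br x (br y z) = br (br x y) z + br y (br x z)"
proof -
  have "br y (br z x) = - br y (br x z)" "br z (br x y) = - br (br x y) z"
    using br_anti[of x z] br_anti[of "br x y" z] by (simp_all add: br_simps)
  then show ?thesis using br_cyclic[of x y z] by (simp add: algebra_simps)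
qed

lemma ideal_subspace: "lie_ideal br I \<Longrightarrow> subspace I"
  by (simp add: lie_ideal_def)

lemma ideal_right: "lie_ideal br I \<Longrightarrow> y \<in> I \<Longrightarrow> br x y \<in> I"
  by (simp add: lie_ideal_def)

lemma ideal_left: "lie_ideal br I \<Longrightarrow> y \<in> I \<Longrightarrow> br y x \<in> I"
  using br_anti[of y x] ideal_right[of I y x] ideal_subspace[of I] by (simp add: subspace_neg)

lemma ideal_UNIV: "lie_ideal br UNIV"
  by (simp add: lie_ideal_def)

lemma ideal_zero: "lie_ideal br {0}"
  by (simp add: lie_ideal_def br_simps)

lemma ideal_bracket:
  assumes I: "lie_ideal br I" and J: "lie_ideal br J"
  shows "lie_ideal br (span {br x y | x y. x \<in> I \<and> y \<in> J})" (is "lie_ideal br (span ?S)")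
  unfolding lie_ideal_def
proof (intro conjI allI impI)
  fix x y assume "y \<in> span ?S"
  then show "br x y \<in> span ?S"
  proof (induction rule: span_induct)
    case base
    show ?case using linear_br subspace_span by (rule linear_subspace_vimage[unfolded vimage_def])
  next
    case (step z)
    then obtain a b where z: "z = br a b" "a \<in> I" "b \<in> J" by blast
    have "br (br x a) b \<in> span ?S" "br a (br x b) \<in> span ?S"
      using z ideal_right[OF I] ideal_right[OF J] by (blast intro: span_base)+
    then show ?case using br_derivation[of x a b] span_add by (simp add: z)
  qed
qed simp

lemma ideal_derived_series: "lie_ideal br (derived_series br k)"
  by (induction k) (auto simp: ideal_UNIV ideal_bracket)

text \<open>The action on \<open>W / U\<close> is transported to a representation \<open>\<rho>\<close> on the whole space that
  factors through a projection \<open>P\<close> onto a complement of \<open>U\<close> in \<open>W\<close>. Since \<open>c\<close> is a sum of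
  commutators \<open>[x, y]\<close> with \<open>y\<close> commuting with \<open>c\<close>, the trace of \<open>c s\<close> vanishes for every \<open>s\<close> in
  the bicommutant of \<open>c\<close>.\<close>

lemma nilpotent_mod_ideal:
  assumes U: "lie_ideal br U" and W: "lie_ideal br W" and UW: "U \<subseteq> W"
    and c: "c \<in> span {br x y | x y. x \<in> UNIV \<and> y \<in> Y}"
    and comm: "\<And>y w. y \<in> Y \<Longrightarrow> w \<in> W \<Longrightarrow> br (br c y) w \<in> U"
  shows "\<exists>n. \<forall>w\<in>W. (br c ^^ n) w \<in> U"
proof -
  note sU = ideal_subspace[OF U] and sW = ideal_subspace[OF W]
  obtain QU where QU: "linear QU" "\<And>x. QU x \<in> U" "\<And>x. x \<in> U \<Longrightarrow> QU x = x"
    by (rule projection_exists[OF sU]) blast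
  obtain QW where QW: "linear QW" "\<And>x. QW x \<in> W" "\<And>x. x \<in> W \<Longrightarrow> QW x = x"
    by (rule projection_exists[OF sW]) blast
  define P where "P = (\<lambda>x. QW x - QU x)"
  have linP: "linear P" unfolding P_def using QW(1) QU(1) by (rule linear_compose_sub)
  have PW: "P x \<in> W" for x using QW(2) QU(2) UW sW by (auto simp: P_def intro: subspace_diff)
  have PU: "P u = 0" if "u \<in> U" for u using that UW QU(3) QW(3) by (auto simp: P_def)
  have PP: "w - P w \<in> U" if "w \<in> W" for w using that QW(3) QU(2) by (simp add: P_def)
  have key: "P (br x (P z)) = P (br x z)" if "z \<in> W" for x z
    using PU[OF ideal_right[OF U PP[OF that], of x]] by (simp add: br_simps linear_diff[OF linP])
  define \<rho> where "\<rho> = (\<lambda>x v. P (br x (P v)))"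
  have lin\<rho>: "linear (\<rho> x)" for x unfolding \<rho>_def
    using linear_compose[OF linear_compose[OF linP linear_br[of x]] linP] by (simp add: o_def)
  have hom: "\<rho> (br x y) v = \<rho> x (\<rho> y v) - \<rho> y (\<rho> x v)" for x y v
  proof -
    have "\<rho> x (\<rho> y v) = P (br x (br y (P v)))" for x y
      using key ideal_right[OF W] PW unfolding \<rho>_def by simp
    then show ?thesis
      by (simp add: \<rho>_def br_derivation[of x y] linear_add[OF linP])
  qed
  have comm\<rho>: "\<rho> y (\<rho> c v) = \<rho> c (\<rho> y v)" if "y \<in> Y" for y v
    using hom[of c y v] PU[OF comm[OF that PW[of v]]] by (simp add: \<rho>_def)
  obtain n where n: "\<And>v. (\<rho> c ^^ n) v = 0"
  proof (rule nilpotent_if_trace_bicommutant[OF lin\<rho>[of c]])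
    fix s :: "'a \<Rightarrow> 'a"
    assume s: "linear s"
      "\<And>y x. linear y \<Longrightarrow> (\<And>x. y (\<rho> c x) = \<rho> c (y x)) \<Longrightarrow> y (s x) = s (y x)"
    have sc: "\<rho> y (s v) = s (\<rho> y v)" if "y \<in> Y" for y v
      using s(2)[OF lin\<rho>] comm\<rho>[OF that] by blast
    show "trace_map (\<lambda>v. \<rho> c (s v)) = 0"
      using c
    proof (induction rule: span_induct)
      case base
      show ?case
        by (auto simp: subspace_def \<rho>_def br_simps linear_add[OF linP] linear_scale[OF linP]
            linear_0[OF linP] trace_map_zero trace_map_add trace_map_scaleR)
    next
      case (step z)
      then obtain x y where z: "z = br x y" "y \<in> Y" by blast
      \<comment> \<open>Cyclicity of the trace, together with \<open>s\<close> commuting with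
        \<open>\<rho> y\<close>, makes the two halves of the commutator cancel.\<close>
      have "trace_map (\<lambda>v. \<rho> y (\<rho> x (s v))) = trace_map (\<lambda>v. \<rho> x (s (\<rho> y v)))"
        using trace_map_commute[OF lin\<rho>[of y] linear_compose[OF s(1) lin\<rho>[of x]]] by simp
      then show ?case by (simp add: z(1) hom trace_map_diff sc[OF z(2)])
    qed
  qed blast
  have "(br c ^^ k) w - (\<rho> c ^^ k) w \<in> U" if "w \<in> W" for k w
  proof (induction k)
    case 0
    then show ?case using subspace_0[OF sU] by simp
  next
    case (Suc k)
    let ?a = "(br c ^^ k) w" and ?b = "(\<rho> c ^^ k) w"
    have "?b \<in> W" by (rule funpow_closed[OF _ that]) (simp add: \<rho>_def PW)
    then have "br c (?a - ?b) \<in> U" "br c (?b - P ?b) \<in> U" "br c (P ?b) - P (br c (P ?b)) \<in> U"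
      using Suc.IH PP PW ideal_right[OF U] ideal_right[OF W] by blast+
    from subspace_add[OF sU subspace_add[OF sU this(1,2)] this(3)]
    show ?case by (simp add: \<rho>_def br_simps)
  qed
  then show ?thesis using n by (metis diff_zero)
qed

text \<open>The elements of \<open>W\<close> that \<open>I\<close> maps into \<open>U\<close> form
  an ideal \<open>K\<close>. On \<open>W\<close> modulo \<open>U\<close> the operators from
  \<open>I\<close> commute and are nilpotent, so a common kernel vector makes \<open>K\<close>
  larger than \<open>U\<close>; minimality leaves \<open>K = W\<close>.\<close>

lemma minimal_ideal_killed:
  assumes U: "lie_ideal br U" and W: "lie_ideal br W" and UW: "U \<subset> W"
    and min: "\<And>K. lie_ideal br K \<Longrightarrow> U \<subseteq> K \<Longrightarrow> K \<subseteq> W \<Longrightarrow> K = U \<or> K = W"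
    and I: "lie_ideal br I"
    and nil: "\<And>i. i \<in> I \<Longrightarrow> \<exists>n. \<forall>w\<in>W. (br i ^^ n) w \<in> U"
    and comm: "\<And>i j w. i \<in> I \<Longrightarrow> j \<in> I \<Longrightarrow> w \<in> W \<Longrightarrow> br (br i j) w \<in> U"
    and "i \<in> I" "w \<in> W"
  shows "br i w \<in> U"
proof -
  note sU = ideal_subspace[OF U] and sW = ideal_subspace[OF W]
  define K where "K = {w \<in> W. \<forall>i\<in>I. br i w \<in> U}"
  have "lie_ideal br K"
    unfolding lie_ideal_def
  proof (intro conjI allI impI)
    show "subspace K" using sU sW by (auto simp: K_def subspace_def br_simps)
    fix x y assume y: "y \<in> K"
    have "br i (br x y) \<in> U" if "i \<in> I" for i
      using y ideal_left[OF I that, of x] ideal_right[OF U] that subspace_add[OF sU]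
      by (auto simp: K_def br_derivation[of i x])
    then show "br x y \<in> K" using y ideal_right[OF W] by (simp add: K_def)
  qed
  moreover have "U \<subseteq> K" using UW ideal_right[OF U] by (auto simp: K_def)
  moreover have "K \<noteq> U"
  proof -
    obtain w where "w \<in> W" "w \<notin> U" "\<And>s. s \<in> br ` I \<Longrightarrow> s w \<in> U"
    proof (rule commuting_nilpotents_common_kernel[OF sU sW UW, of "br ` I"])
      show "s (t w) - t (s w) \<in> U" if "s \<in> br ` I" "t \<in> br ` I" "w \<in> W" for s t w
      proof -
        from that obtain i j where "i \<in> I" "j \<in> I" "s = br i" "t = br j" by blast
        then show ?thesis using comm[of i j w] that by (simp add: br_derivation[of i j])
      qed
    qed (use linear_br ideal_right[OF U] ideal_right[OF W] nil in auto)
    then show ?thesis by (auto simp: K_def)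
  qed
  ultimately have "K = W" using min[of K] by (auto simp: K_def)
  then show ?thesis using \<open>i \<in> I\<close> \<open>w \<in> W\<close> by (auto simp: K_def)
qed

section \<open>Chains of ideals and nilpotency\<close>

lemma minimal_ideal_exists:
  assumes U: "lie_ideal br U" and "U \<noteq> UNIV"
  obtains W where "lie_ideal br W" "U \<subset> W"
    "\<And>K. lie_ideal br K \<Longrightarrow> U \<subseteq> K \<Longrightarrow> K \<subseteq> W \<Longrightarrow> K = U \<or> K = W"
proof -
  let ?Q = "\<lambda>W. lie_ideal br W \<and> U \<subset> W"
  have "?Q UNIV" using assms ideal_UNIV by blast
  then obtain W where W: "?Q W" and min: "\<And>K. ?Q K \<Longrightarrow> dim W \<le> dim K"
    using exists_minimal_dim[of ?Q UNIV] by blast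
  show thesis
  proof (rule that)
    fix K assume K: "lie_ideal br K" "U \<subseteq> K" "K \<subseteq> W"
    show "K = U \<or> K = W"
    proof (cases "K = U")
      case False
      then have "dim W \<le> dim K" using min K by blast
      then show ?thesis
        using subspace_dim_equal[OF ideal_subspace ideal_subspace] K W by blast
    qed simp
  qed (use W in auto)
qed

text \<open>Descent along the derived series, each time in two stages: first the brackets of the
  whole algebra with \<open>derived_series br j\<close>, nilpotent because they commute on the
  quotient with that term; then the term itself, whose brackets with everything are by then known to
  act by zero.\<close>

lemma derived_kills_minimal_ideal:
  assumes solv: "solvable_lie br"
    and U: "lie_ideal br U" and W: "lie_ideal br W" and UW: "U \<subset> W"
    and min: "\<And>K. lie_ideal br K \<Longrightarrow> U \<subseteq> K \<Longrightarrow> K \<subseteq> W \<Longrightarrow> K = U \<or> K = W"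
    and "d \<in> derived_series br 1" "w \<in> W"
  shows "br d w \<in> U"
proof -
  define kills where "kills j \<longleftrightarrow> (\<forall>d\<in>derived_series br j. \<forall>w\<in>W. br d w \<in> U)" for j
  obtain k where k: "derived_series br k = {0}" using solv by (auto simp: solvable_lie_def)
  \<comment> \<open>One term beyond \<open>k\<close>, so that the starting index is at least 1 even
    when \<open>k = 0\<close>; the descent ends at 1.\<close>
  have Suc1: "derived_series br (Suc k) = {0}"
    using k by (auto simp: br_simps)
  have "kills (Suc k)" unfolding kills_def Suc1 using subspace_0[OF ideal_subspace[OF U]] by (simp add: br_simps)
  have step: "kills j" if j: "1 \<le> j" and Sj: "kills (Suc j)" for j
  proof -
    let ?D = "derived_series br j"
    let ?I = "span {br x y | x y. x \<in> UNIV \<and> y \<in> ?D}"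
    have D: "lie_ideal br ?D" by (rule ideal_derived_series)
    have I: "lie_ideal br ?I" by (rule ideal_bracket[OF ideal_UNIV D])
    have ID: "?I \<subseteq> ?D"
      by (rule span_minimal) (use ideal_right[OF D] ideal_subspace[OF D] in auto)
    have DD: "br (br c y) w \<in> U" if "c \<in> ?D" "y \<in> ?D" "w \<in> W" for c y w
    proof -
      have "br c y \<in> derived_series br (Suc j)" using that by (auto intro: span_base)
      then show ?thesis using Sj that by (auto simp: kills_def)
    qed
    have Ikills: "br c w \<in> U" if "c \<in> ?I" "w \<in> W" for c w
    proof (rule minimal_ideal_killed[OF U W UW min I _ _ that])
      show "\<exists>n. \<forall>w\<in>W. (br i ^^ n) w \<in> U" if "i \<in> ?I" for i
        by (rule nilpotent_mod_ideal[OF U W _ that]) (use UW DD ID that in auto)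
      show "br (br i i') w \<in> U" if "i \<in> ?I" "i' \<in> ?I" "w \<in> W" for i i' w
        using that ID by (intro DD) auto
    qed
    \<comment> \<open>Here \<open>j \<ge> 1\<close> matters: elements of \<open>?D\<close> must be
      sums of brackets for the trace argument to apply.\<close>
    have "?D \<subseteq> derived_series br 1"
    proof -
      obtain i where "j = Suc i" using j by (cases j) auto
      then show ?thesis by (simp add: span_mono Collect_mono_iff) (intro span_mono, blast)
    qed
    then have D1: "?D \<subseteq> span {br x y | x y. x \<in> UNIV \<and> y \<in> UNIV}" by simp
    have cI: "br c y \<in> ?I" if "c \<in> ?D" for c y
    proof -
      have "br y c \<in> ?I" using that by (auto intro: span_base)
      from span_neg[OF this] show ?thesis by (simp only: br_anti[of c y])
    qed
    have "br c w \<in> U" if "c \<in> ?D" "w \<in> W" for c w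
    proof (rule minimal_ideal_killed[OF U W UW min D _ _ that])
      show "\<exists>n. \<forall>w\<in>W. (br i ^^ n) w \<in> U" if "i \<in> ?D" for i
        by (rule nilpotent_mod_ideal[OF U W _ subsetD[OF D1 that]]) (use UW Ikills cI that in auto)
    qed (use DD in auto)
    then show ?thesis by (simp add: kills_def)
  qed
  have "kills 1"
    by (rule inc_induct[of 1 "Suc k" kills]) (use \<open>kills (Suc k)\<close> step in auto)
  then show ?thesis using assms by (simp add: kills_def)
qed

text \<open>Induction on the codimension of \<open>U\<close>: the lower central series of
  \<open>H\<close> eventually lies in the larger ideal \<open>W\<close>, and one more bracket with
  \<open>H\<close> brings it into \<open>U\<close>. The case \<open>U = {0}\<close> is the
  claim.\<close>

lemma nilpotent_if_flag:
  assumes H: "subspace H"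
    and step: "\<And>U. lie_ideal br U \<Longrightarrow> U \<noteq> UNIV \<Longrightarrow>
      \<exists>W. lie_ideal br W \<and> U \<subset> W \<and> (\<forall>h\<in>H. \<forall>w\<in>W. br h w \<in> U)"
  shows "nilpotent_sub br H"
proof -
  have "\<exists>k. lower_central br H k \<subseteq> U" if "lie_ideal br U" for U
    using that
  proof (induction "DIM('a) - dim U" arbitrary: U rule: less_induct)
    case less
    show ?case
    proof (cases "U = UNIV")
      case False
      then obtain W where W: "lie_ideal br W" "U \<subset> W" "\<forall>h\<in>H. \<forall>w\<in>W. br h w \<in> U"
        using step less.prems by blast
      have "dim U < dim W"
        using dim_less_psubspace ideal_subspace W less.prems by blast
      moreover have "dim W \<le> DIM('a)" by (rule dim_subset_UNIV)
      ultimately have "DIM('a) - dim W < DIM('a) - dim U" by linarith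
      then obtain k where k: "lower_central br H k \<subseteq> W"
        using less.hyps W(1) by blast
      have "lower_central br H (Suc k) \<subseteq> U"
        unfolding lower_central.simps
        by (rule span_minimal[OF _ ideal_subspace[OF less.prems]]) (use k W(3) in blast)
      then show ?thesis by blast
    qed auto
  qed
  then obtain k where k: "lower_central br H k \<subseteq> {0}" using ideal_zero by blast
  moreover have "0 \<in> lower_central br H k"
    using subspace_0[OF H] by (cases k) (auto simp: span_zero)
  ultimately show ?thesis unfolding nilpotent_sub_def by blast
qed

lemma nilpotent_derived:
  assumes solv: "solvable_lie br"
  shows "nilpotent_sub br (derived_series br 1)"
proof (rule nilpotent_if_flag[OF ideal_subspace[OF ideal_derived_series]])
  fix U assume U: "lie_ideal br U" "U \<noteq> UNIV"
  show "\<exists>W. lie_ideal br W \<and> U \<subset> W \<and> (\<forall>h\<in>derived_series br 1. \<forall>w\<in>W. br h w \<in> U)"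
    by (rule minimal_ideal_exists[OF U]) (meson derived_kills_minimal_ideal[OF solv U(1)])
qed

text \<open>Engel's theorem in the solvable case: on a minimal step \<open>W\<close> over
  \<open>U\<close> the derived algebra acts by zero, so all \<open>br i\<close> commute there; being
  nilpotent, they act by zero too.\<close>

lemma engel_solvable:
  assumes solv: "solvable_lie br" and nil: "\<And>x. \<exists>n. \<forall>w. (br x ^^ n) w = 0"
  shows "nilpotent_lie br"
  unfolding nilpotent_lie_def
proof (rule nilpotent_if_flag[OF subspace_UNIV])
  fix U assume U: "lie_ideal br U" "U \<noteq> UNIV"
  obtain W where W: "lie_ideal br W" "U \<subset> W"
    and min: "\<And>K. lie_ideal br K \<Longrightarrow> U \<subseteq> K \<Longrightarrow> K \<subseteq> W \<Longrightarrow> K = U \<or> K = W"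
    by (rule minimal_ideal_exists[OF U]) blast
  have "br i w \<in> U" if "w \<in> W" for i w
  proof (rule minimal_ideal_killed[OF U(1) W min ideal_UNIV _ _ UNIV_I that])
    show "\<exists>n. \<forall>w\<in>W. (br i ^^ n) w \<in> U" for i
      using nil[of i] subspace_0[OF ideal_subspace[OF U(1)]] by metis
    show "br (br i j) w \<in> U" if "w \<in> W" for i j w
      by (rule derived_kills_minimal_ideal[OF solv U(1) W min _ that]) (auto intro: span_base)
  qed
  then show "\<exists>W. lie_ideal br W \<and> U \<subset> W \<and> (\<forall>h\<in>UNIV. \<forall>w\<in>W. br h w \<in> U)"
    using W by blast
qed

end

section \<open>Skew operators for a scalar product\<close>

text \<open>Gram-Schmidt for an indefinite form: split off a normalised non-isotropic vector, found
  by polarization, and recurse on its orthogonal complement, which is again non-degenerate. A sign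
  is its own inverse, whence the coefficients \<open>sp b b * sp x b\<close>.\<close>

lemma pseudo_orthonormal_basis:
  fixes sp :: "'a::euclidean_space \<Rightarrow> 'a \<Rightarrow> real"
  assumes bil: "bilinear sp" and sym: "\<And>x y. sp x y = sp y x" and S: "subspace S"
    and nondeg: "\<And>x. x \<in> S \<Longrightarrow> (\<And>y. y \<in> S \<Longrightarrow> sp x y = 0) \<Longrightarrow> x = 0"
  shows "\<exists>B. finite B \<and> B \<subseteq> S \<and> card B = dim S \<and> (\<forall>b\<in>B. sp b b = 1 \<or> sp b b = - 1) \<and>
    (\<forall>a\<in>B. \<forall>b\<in>B. a \<noteq> b \<longrightarrow> sp a b = 0) \<and> (\<forall>x\<in>S. x = (\<Sum>b\<in>B. (sp b b * sp x b) *\<^sub>R b))"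
  using S nondeg
proof (induction "dim S" arbitrary: S rule: less_induct)
  case less
  note sps = bilinear_ladd[OF bil] bilinear_radd[OF bil] bilinear_lmul[OF bil] bilinear_rmul[OF bil]
    bilinear_lsub[OF bil] bilinear_rsub[OF bil] bilinear_lzero[OF bil] bilinear_rzero[OF bil]
  show ?case
  proof (cases "S \<subseteq> {0}")
    case True
    then show ?thesis by (intro exI[of _ "{}"]) auto
  next
    case False
    have "\<exists>v\<in>S. sp v v \<noteq> 0"
    proof (rule ccontr)
      assume *: "\<not> (\<exists>v\<in>S. sp v v \<noteq> 0)"
      have "sp x y = 0" if "x \<in> S" "y \<in> S" for x y
      proof -
        have "sp (x + y) (x + y) = 0" "sp x x = 0" "sp y y = 0"
          using * that subspace_add[OF less.prems(1)] by auto
        then show ?thesis using sym[of x y] by (simp add: sps)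
      qed
      then show False using less.prems(2) False by blast
    qed
    then obtain v where v: "v \<in> S" "sp v v \<noteq> 0" by blast
    define u where "u = (1 / sqrt \<bar>sp v v\<bar>) *\<^sub>R v"
    have u: "u \<in> S" using v subspace_scale[OF less.prems(1)] by (simp add: u_def)
    have "sp u u = sp v v / \<bar>sp v v\<bar>" using v by (simp add: u_def sps)
    then have uu: "sp u u = 1 \<or> sp u u = - 1" using v by (auto simp: abs_if)
    define S' where "S' = {y \<in> S. sp y u = 0}"
    have S': "subspace S'" using less.prems(1) by (auto simp: S'_def subspace_def sps)
    define p where "p x = x - (sp u u * sp x u) *\<^sub>R u" for x
    have p: "p x \<in> S'" if "x \<in> S" for x
      using that u uu less.prems(1)
      by (auto simp: p_def S'_def sps intro: subspace_diff subspace_add subspace_scale)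
    have nd: "x = 0" if x: "x \<in> S'" "\<And>y. y \<in> S' \<Longrightarrow> sp x y = 0" for x
    proof (rule less.prems(2))
      show "x \<in> S" using x by (simp add: S'_def)
      fix y assume "y \<in> S"
      then have "sp x (p y) = 0" by (intro x p)
      then show "sp x y = 0" using x(1) by (simp add: p_def S'_def sps)
    qed
    have uS': "u \<notin> S'" using uu by (auto simp: S'_def)
    have "S = span (insert u S')"
    proof
      show "S \<subseteq> span (insert u S')"
      proof
        fix x assume "x \<in> S"
        then have "p x \<in> span (insert u S')" using p by (simp add: span_base)
        moreover have "(sp u u * sp x u) *\<^sub>R u \<in> span (insert u S')"
          by (simp add: span_base span_scale)
        ultimately have "p x + (sp u u * sp x u) *\<^sub>R u \<in> span (insert u S')" by (rule span_add)
        then show "x \<in> span (insert u S')" by (simp add: p_def)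
      qed
      show "span (insert u S') \<subseteq> S" using u less.prems(1) by (intro span_minimal) (auto simp: S'_def)
    qed
    then have "dim S = dim (insert u S')" by (metis dim_span)
    then have dimS: "dim S = dim S' + 1" using uS' S' by (simp add: dim_insert span_eq_iff[THEN iffD2])
    then obtain B where B: "finite B" "B \<subseteq> S'" "card B = dim S'" "\<forall>b\<in>B. sp b b = 1 \<or> sp b b = - 1"
      "\<forall>a\<in>B. \<forall>b\<in>B. a \<noteq> b \<longrightarrow> sp a b = 0" "\<forall>x\<in>S'. x = (\<Sum>b\<in>B. (sp b b * sp x b) *\<^sub>R b)"
      using less.hyps[of S'] S' nd by auto
    have uB: "u \<notin> B" using uS' B(2) by blast
    have Bu: "sp b u = 0" "sp u b = 0" if "b \<in> B" for b
      using that B(2) sym[of u b] by (auto simp: S'_def)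
    show ?thesis
    proof (intro exI[of _ "insert u B"] conjI)
      show "card (insert u B) = dim S" using B(1,3) uB dimS by simp
      show "\<forall>x\<in>S. x = (\<Sum>b\<in>insert u B. (sp b b * sp x b) *\<^sub>R b)"
      proof
        fix x assume "x \<in> S"
        have "p x = (\<Sum>b\<in>B. (sp b b * sp (p x) b) *\<^sub>R b)" using B(6) p[OF \<open>x \<in> S\<close>] by blast
        also have "\<dots> = (\<Sum>b\<in>B. (sp b b * sp x b) *\<^sub>R b)"
          by (rule sum.cong) (auto simp: p_def sps Bu)
        finally show "x = (\<Sum>b\<in>insert u B. (sp b b * sp x b) *\<^sub>R b)"
          using B(1) uB by (simp add: p_def algebra_simps)
      qed
    qed (use B u uu Bu in \<open>auto simp: S'_def\<close>)
  qed
qed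

text \<open>Everything reduces to the Fitting one-component: the form stays non-degenerate there,
  and the nilpotent remainder of \<open>f\<close> contributes nothing to the trace of
  \<open>f\<close> squared.\<close>

lemma skew_operator_trace_square_zero:
  fixes sp :: "'a::euclidean_space \<Rightarrow> 'a \<Rightarrow> real"
  assumes sp: "scalar_product sp" and f: "linear f"
    and skew: "\<And>x y. sp (f x) y = - sp x (f y)"
    and tr: "trace_map (\<lambda>x. f (f x)) = 0"
    and not_nil: "\<And>n. \<exists>w. (f ^^ n) w \<noteq> 0"
  obtains n where "n > 0" "dim (range (f ^^ n)) \<ge> 4"
    "\<exists>v\<in>range (f ^^ n). v \<noteq> 0 \<and> sp v v = 0"
    "\<forall>v\<in>range (f ^^ n). f v = 0 \<longrightarrow> v = 0"
proof -
  have bil: "bilinear sp" and sym: "\<And>x y. sp x y = sp y x"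
    and nondeg: "\<And>x. (\<And>y. sp x y = 0) \<Longrightarrow> x = 0"
    using sp by (auto simp: scalar_product_def)
  note sps = bilinear_ladd[OF bil] bilinear_radd[OF bil] bilinear_lmul[OF bil] bilinear_rmul[OF bil]
    bilinear_lsub[OF bil] bilinear_rsub[OF bil] bilinear_lzero[OF bil] bilinear_rzero[OF bil]
  obtain n g where n: "n > 0" and g: "linear g"
    and fit: "\<forall>v\<in>range (f ^^ n). f v \<in> range (f ^^ n) \<and> g v \<in> range (f ^^ n) \<and> g (f v) = v \<and> f (g v) = v"
    by (rule fitting_decomposition[OF f])
  define V where "V = range (f ^^ n)"
  have V: "f v \<in> V" "g v \<in> V" "g (f v) = v" "f (g v) = v" if "v \<in> V" for v
    using fit that unfolding V_def by blast+
  have linf: "linear (f ^^ k)" and ling: "linear (g ^^ k)" for k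
    using linear_funpow f g by auto
  have subV: "subspace V" unfolding V_def by (rule linear_subspace_image[OF linf subspace_UNIV])
  have injV: "v = 0" if "v \<in> V" "f v = 0" for v
    using V(3)[OF that(1)] that(2) linear_0[OF g] by simp
  have fV: "(f ^^ n) x \<in> V" for x by (simp add: V_def)
  have fkV: "(f ^^ k) v \<in> V" and gV: "(g ^^ k) v \<in> V" if "v \<in> V" for k v
    using funpow_closed[of V f] funpow_closed[of V g] V that by auto
  have injVk: "v = 0" if "v \<in> V" "(f ^^ k) v = 0" for k v
    using that(2) by (induction k) (use that(1) injV fkV in auto)
  have skewk: "sp ((f ^^ k) x) y = (-1) ^ k * sp x ((f ^^ k) y)" for k x y
    by (induction k arbitrary: y) (simp_all add: skew funpow_swap1[symmetric])
  \<comment> \<open>Up to sign \<open>f ^^ n\<close> moves across the form, so a vector orthogonal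
    to the range of \<open>f ^^ n\<close> is in its kernel; on \<open>V\<close> this kernel is
    zero.\<close>
  have nondegV: "x = 0" if x: "x \<in> V" "\<And>y. y \<in> V \<Longrightarrow> sp x y = 0" for x
  proof (rule injVk[OF x(1), of n], rule nondeg)
    show "sp ((f ^^ n) x) y = 0" for y using x(2)[OF fV[of y]] by (simp add: skewk)
  qed
  obtain B where B: "finite B" "B \<subseteq> V" "card B = dim V" "\<forall>b\<in>B. sp b b = 1 \<or> sp b b = - 1"
    "\<forall>a\<in>B. \<forall>b\<in>B. a \<noteq> b \<longrightarrow> sp a b = 0" "\<forall>x\<in>V. x = (\<Sum>b\<in>B. (sp b b * sp x b) *\<^sub>R b)"
    using pseudo_orthonormal_basis[OF bil sym subV nondegV] by blast
  \<comment> \<open>The projection onto \<open>V\<close> along the kernel of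
    \<open>f ^^ n\<close>.\<close>
  define E where "E = (\<lambda>x. (g ^^ n) ((f ^^ n) x))"
  have linE: "linear E" unfolding E_def using linear_compose[OF linf[of n] ling[of n]] by (simp add: o_def)
  have EV: "E x \<in> V" for x by (simp add: E_def fV gV)
  have fg: "(f ^^ k) ((g ^^ k) v) = v" and gf: "(g ^^ k) ((f ^^ k) v) = v" if "v \<in> V" for k v
  proof -
    show "(f ^^ k) ((g ^^ k) v) = v"
      using that by (induction k arbitrary: v) (simp_all add: V gV funpow_swap1[of f])
    show "(g ^^ k) ((f ^^ k) v) = v"
      using that by (induction k arbitrary: v) (simp_all add: V fkV funpow_swap1[of g])
  qed
  have E_id: "E v = v" if "v \<in> V" for v using gf that by (simp add: E_def)
  have fnE: "(f ^^ n) (E x) = (f ^^ n) x" for x by (simp add: E_def fg fV)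
  have Ef: "E (f x) = f (E x)" for x
  proof -
    have "(f ^^ n) (E (f x) - f (E x)) = 0"
      using fnE[of x] fnE[of "f x"] by (simp add: linear_diff[OF linf] funpow_swap1[symmetric])
    moreover have "E (f x) - f (E x) \<in> V" using EV V subV by (simp add: subspace_diff)
    ultimately show ?thesis using injVk by force
  qed
  have Efk: "E ((f ^^ k) x) = (f ^^ k) (E x)" for k x by (induction k) (auto simp: Ef)
  \<comment> \<open>This is \<open>f\<close> squared on the Fitting null-component; its nilpotency
    reduces the trace condition to \<open>V\<close>.\<close>
  define h where "h = (\<lambda>x. f (f x) - f (f (E x)))"
  have "linear h" unfolding h_def
    using linear_compose_sub[OF linear_compose[OF f f] linear_compose[OF linE linear_compose[OF f f]]]
    by (simp add: o_def)
  moreover have "(h ^^ n) x = 0" for x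
  proof -
    have "(h ^^ Suc k) x = (f ^^ (2 * Suc k)) (x - E x)" for k
    proof (induction k)
      case 0
      then show ?case by (simp add: h_def linear_diff[OF f] numeral_2_eq_2)
    next
      case (Suc k)
      have "E ((f ^^ (2 * Suc k)) (x - E x)) = 0"
        using E_id[OF EV[of x]] by (simp add: Efk linear_diff[OF linE] linear_0[OF linf] del: funpow.simps)
      then have "h ((f ^^ (2 * Suc k)) (x - E x)) = f (f ((f ^^ (2 * Suc k)) (x - E x)))"
        by (simp add: h_def linear_0[OF f] del: funpow.simps)
      then show ?case using Suc.IH by simp
    qed
    from this[of "n - 1"] have "(h ^^ n) x = (f ^^ (n + n)) (x - E x)" using n by (simp add: mult_2)
    also have "\<dots> = 0"
      using fnE[of x] by (simp add: funpow_add linear_diff[OF linf] linear_0[OF linf])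
    finally show ?thesis .
  qed
  ultimately have "trace_map h = 0" by (rule trace_map_nilpotent)
  then have "trace_map (\<lambda>x. f (f (E x))) = 0" using tr by (simp add: h_def trace_map_diff)
  moreover have "f (f (E x)) = (\<Sum>b\<in>B. (sp b b * sp (E x) b) *\<^sub>R f (f b))" for x
  proof -
    have "E x = (\<Sum>b\<in>B. (sp b b * sp (E x) b) *\<^sub>R b)" using B(6) EV by blast
    then have "f (f (E x)) = f (f (\<Sum>b\<in>B. (sp b b * sp (E x) b) *\<^sub>R b))" by simp
    then show ?thesis by (simp add: linear_sum linear_scale f)
  qed
  moreover have "linear (\<lambda>x. sp b b * sp (E x) b)" for b
    by (rule linearI) (auto simp: sps linear_add[OF linE] linear_scale[OF linE] algebra_simps)
  moreover have "E (f (f b)) = f (f b)" if "b \<in> B" for b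
    by (rule E_id, rule V(1), rule V(1)) (use that B(2) in blast)
  ultimately have "(\<Sum>b\<in>B. sp b b * sp (f (f b)) b) = 0"
    by (simp add: trace_map_sum trace_map_rank_one)
  moreover have "sp (f (f b)) b = - (\<Sum>c\<in>B. sp c c * (sp (f b) c)\<^sup>2)" if "b \<in> B" for b
  proof -
    have "f b = (\<Sum>c\<in>B. (sp c c * sp (f b) c) *\<^sub>R c)" using B(6) V(1)[of b] B(2) that by blast
    then have "sp (f b) (f b) = sp (f b) (\<Sum>c\<in>B. (sp c c * sp (f b) c) *\<^sub>R c)" by simp
    also have "\<dots> = (\<Sum>c\<in>B. (sp c c * sp (f b) c) * sp (f b) c)"
      using bil by (simp add: bilinear_def linear_sum linear_scale)
    finally show ?thesis by (simp add: skew[of "f b"] power2_eq_square mult.assoc)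
  qed
  ultimately have sum0: "(\<Sum>b\<in>B. \<Sum>c\<in>B. sp b b * sp c c * (sp (f b) c)\<^sup>2) = 0"
    by (simp add: sum_negf sum_distrib_left mult.assoc)
  have anti: "sp (f b) a = - sp (f a) b" for a b using skew[of b a] sym[of b "f a"] by simp
  have diag: "sp (f b) b = 0" for b using anti[of b b] by simp
  have kerB: "w = 0" if "w \<in> V" "\<And>b. b \<in> B \<Longrightarrow> sp (f w) b = 0" for w
  proof -
    have "f w = (\<Sum>b\<in>B. (sp b b * sp (f w) b) *\<^sub>R b)" using B(6) V(1)[OF that(1)] by blast
    then show ?thesis using that injV by simp
  qed
  have B0: "b \<noteq> 0" if "b \<in> B" for b using B(4) that by (auto simp: sps)
  have Bne: "B \<noteq> {}"
  proof
    assume "B = {}"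
    then have "V \<subseteq> {0}" using B(6) by auto
    then show False using not_nil[of n] fV by blast
  qed
  \<comment> \<open>Two basis vectors of opposite sign add up to an isotropic vector. With equal
    signs the signed sum is a sum of squares, so \<open>f\<close> would vanish on \<open>V\<close>,
    against its injectivity.\<close>
  have "\<exists>v\<in>V. v \<noteq> 0 \<and> sp v v = 0"
  proof (cases "\<exists>b\<in>B. \<exists>c\<in>B. sp b b \<noteq> sp c c")
    case True
    then obtain b c where bc: "b \<in> B" "c \<in> B" "sp b b \<noteq> sp c c" by blast
    then have "b \<noteq> c" by blast
    then have "sp b c = 0" "sp c b = 0" using B(5) bc by auto
    moreover have "sp b b + sp c c = 0" using bspec[OF B(4) bc(1)] bspec[OF B(4) bc(2)] bc(3) by auto
    ultimately have "sp (b + c) (b + c) = 0" "sp (b + c) b \<noteq> 0" using bspec[OF B(4) bc(1)] by (auto simp: sps)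
    then have "sp (b + c) (b + c) = 0" "b + c \<noteq> 0" by (auto simp: bilinear_lzero[OF bil])
    then show ?thesis using bc B(2) subV by (intro bexI[of _ "b + c"]) (auto intro: subspace_add)
  next
    case False
    have "sp b b * sp c c = 1" if "b \<in> B" "c \<in> B" for b c
    proof -
      have "sp b b = sp c c" using False that by blast
      then show ?thesis using bspec[OF B(4) that(2)] by auto
    qed
    then have "(\<Sum>b\<in>B. \<Sum>c\<in>B. (sp (f b) c)\<^sup>2) = 0" using sum0 by simp
    then have f0: "sp (f b) c = 0" if "b \<in> B" "c \<in> B" for b c
      using that B(1) by (simp add: sum_nonneg_eq_0_iff sum_nonneg)
    obtain b where b: "b \<in> B" using Bne by blast
    have "b = 0" by (rule kerB) (use B(2) b f0 in auto)
    then show ?thesis using B0[OF b] by simp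
  qed
  \<comment> \<open>In dimension 1 a skew matrix is zero; in dimension 2 the signed sum is a nonzero
    multiple of the square of its only entry; in dimension 3 it is singular. Each contradicts
    injectivity of \<open>f\<close> on \<open>V\<close>.\<close>
  moreover have "card B \<ge> 4"
  proof (rule ccontr)
    assume "\<not> 4 \<le> card B"
    moreover have "card B \<noteq> 0" using B(1) Bne by simp
    ultimately consider "card B = 1" | "card B = 2" | "card B = 3" by linarith
    then show False
    proof cases
      case 1
      then obtain a where "B = {a}" by (auto simp: card_1_singleton_iff)
      then show False using kerB[of a] B(2) B0 diag by auto
    next
      case 2
      then obtain a b where ab: "B = {a, b}" "a \<noteq> b" by (auto simp: card_2_iff)
      have "sp a a * sp b b * (sp (f a) b)\<^sup>2 = 0"
        using sum0 ab(2) by (simp add: ab(1) diag anti[of b a] mult.commute)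
      then have "sp (f a) b = 0" using B(4) by (auto simp: ab(1))
      then show False using kerB[of a] B(2) B0 diag ab(1) by auto
    next
      case 3
      then obtain a b c where abc: "B = {a, b, c}" "a \<noteq> b" "b \<noteq> c" "a \<noteq> c"
        by (auto simp: card_3_iff)
      \<comment> \<open>a skew \<open>3 \<times> 3\<close> matrix annihilates the vector of its (signed) entries\<close>
      define w where "w = sp (f b) c *\<^sub>R a - sp (f a) c *\<^sub>R b + sp (f a) b *\<^sub>R c"
      have "w = 0"
      proof (rule kerB)
        show "w \<in> V" using B(2) subV
          by (auto simp: w_def abc(1) intro: subspace_add subspace_diff subspace_scale)
        show "sp (f w) d = 0" if "d \<in> B" for d
          using that anti[of a b] anti[of a c] anti[of b c]
          by (auto simp: w_def abc(1) linear_add[OF f] linear_diff[OF f] linear_scale[OF f] sps diag)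
      qed
      then have "sp w b = 0" "sp w c = 0" by (simp_all add: sps)
      then have "sp (f a) b = 0" "sp (f a) c = 0"
        using B(4,5) abc by (auto simp: w_def sps)
      then show False using kerB[of a] B(2) B0 diag abc(1) by auto
    qed
  qed
  ultimately show thesis using that[OF n] B(3) injV unfolding V_def by auto
qed

section \<open>Metric Lie algebras\<close>

locale metric_lie = lie br for br :: "'a::euclidean_space \<Rightarrow> 'a \<Rightarrow> 'a" +
  fixes sp :: "'a \<Rightarrow> 'a \<Rightarrow> real"
  assumes invariant_sp: "invariant_sp br sp"
begin

lemma bilinear_sp: "bilinear sp" and sp_sym: "sp x y = sp y x"
  and sp_nondeg: "(\<And>y. sp x y = 0) \<Longrightarrow> x = 0" and sp_br: "sp (br x y) z = - sp y (br x z)"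
  using invariant_sp unfolding invariant_sp_def scalar_product_def by blast+

lemmas sp_simps = bilinear_ladd[OF bilinear_sp] bilinear_radd[OF bilinear_sp]
  bilinear_lmul[OF bilinear_sp] bilinear_rmul[OF bilinear_sp]
  bilinear_lsub[OF bilinear_sp] bilinear_rsub[OF bilinear_sp]
  bilinear_lzero[OF bilinear_sp] bilinear_rzero[OF bilinear_sp]
  bilinear_lneg[OF bilinear_sp] bilinear_rneg[OF bilinear_sp]

text \<open>By invariance the last two terms of the Koszul formula cancel; non-degeneracy gives the
  uniqueness that \<open>THE\<close> requires.\<close>

lemma lc_conn_eq: "lc_conn br sp x y = (1/2) *\<^sub>R br x y"
  unfolding lc_conn_def
proof (rule the_equality)
  have *: "sp (br x y) z - sp (br y z) x + sp (br z x) y = sp (br x y) z" for z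
    using sp_br[of y z x] sp_br[of x z y] br_anti[of y x] br_anti[of x z] sp_sym[of z "br x y"]
    by (simp add: sp_simps)
  then show "\<forall>z. 2 * sp ((1/2) *\<^sub>R br x y) z = sp (br x y) z - sp (br y z) x + sp (br z x) y"
    by (simp add: sp_simps)
  fix w assume "\<forall>z. 2 * sp w z = sp (br x y) z - sp (br y z) x + sp (br z x) y"
  then have "2 * sp w z = sp (br x y) z" for z using * by simp
  then have "sp (w - (1/2) *\<^sub>R br x y) z = 0" for z by (simp add: sp_simps mult.commute)
  then show "w = (1/2) *\<^sub>R br x y" using sp_nondeg[of "w - (1/2) *\<^sub>R br x y"] by simp
qed

text \<open>The half-bracket connection gives curvature with coefficient 1/4 on the commutator of
  \<open>br x\<close> and \<open>br y\<close> and -1/2 on \<open>br (br x y)\<close>; Jacobi merges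
  these into -1/4.\<close>

lemma ricci_eq: "ricci br sp y z = (-1/4) * trace_map (\<lambda>x. br z (br y x))"
proof -
  have "curvature br sp x y z = (-1/4) *\<^sub>R br z (br y x)" for x
  proof -
    have "curvature br sp x y z = (1/4) *\<^sub>R (br x (br y z) - br y (br x z)) - (1/2) *\<^sub>R br (br x y) z"
      by (simp add: curvature_def lc_conn_eq br_simps scaleR_diff_right)
    also have "\<dots> = (1/4 - 1/2) *\<^sub>R br (br x y) z"
      by (simp add: br_derivation[of x y] flip: scaleR_diff_left)
    also have "br (br x y) z = br z (br y x)"
      using br_anti[of "br x y" z] br_anti[of x y] by (simp add: br_simps)
    finally show ?thesis by simp
  qed
  then show ?thesis by (simp only: ricci_def trace_map_scaleR)
qed

text \<open>By invariance the orthogonal complement of the derived algebra is central. If the two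
  met only in zero, every element would be central modulo the derived algebra, making the latter
  perfect; solvability would then force the algebra to be abelian.\<close>

lemma derived_meets_center:
  assumes solv: "solvable_lie br" and not_nil: "\<not> nilpotent_lie br"
  obtains e where "e \<noteq> 0" "e \<in> derived_series br 1" "\<And>x. br x e = 0"
proof -
  let ?D = "derived_series br 1"
  have D: "subspace ?D" by (rule ideal_subspace[OF ideal_derived_series])
  have brD: "br x y \<in> ?D" for x y by (auto intro: span_base)
  have cent: "br x c = 0" if "\<And>d. d \<in> ?D \<Longrightarrow> sp c d = 0" for x c
  proof (rule sp_nondeg)
    show "sp (br x c) z = 0" for z using that[OF brD, of x z] by (simp add: sp_br)
  qed
  have "\<exists>e\<in>?D. e \<noteq> 0 \<and> (\<forall>d\<in>?D. sp e d = 0)"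
  proof (rule ccontr)
    assume *: "\<not> ?thesis"
    obtain B where B: "finite B" "B \<subseteq> ?D" "\<forall>b\<in>B. sp b b = 1 \<or> sp b b = - 1"
      "\<forall>a\<in>B. \<forall>b\<in>B. a \<noteq> b \<longrightarrow> sp a b = 0" "\<forall>x\<in>?D. x = (\<Sum>b\<in>B. (sp b b * sp x b) *\<^sub>R b)"
      using pseudo_orthonormal_basis[OF bilinear_sp sp_sym D] * by blast
    have lin: "linear (sp x)" "linear (\<lambda>y. sp y x)" for x using bilinear_sp by (auto simp: bilinear_def)
    have split: "\<exists>d\<in>?D. \<forall>x. br x (y - d) = 0" for y
    proof
      let ?d = "\<Sum>b\<in>B. (sp b b * sp y b) *\<^sub>R b"
      show "?d \<in> ?D" using B(2) D by (auto intro!: subspace_sum subspace_scale)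
      have yb: "sp (y - ?d) b = 0" if "b \<in> B" for b
      proof -
        have "sp ?d b = (\<Sum>a\<in>B. (sp a a * sp y a) * sp a b)"
          by (simp add: linear_sum[OF lin(2)] sp_simps)
        also have "\<dots> = (\<Sum>a\<in>B. if a = b then (sp b b * sp y b) * sp b b else 0)"
          by (rule sum.cong) (use B(4) that in auto)
        also have "\<dots> = sp y b" using B(1,3) that by auto
        finally show ?thesis by (simp add: sp_simps)
      qed
      have "sp (y - ?d) x = 0" if "x \<in> ?D" for x
      proof -
        have "x = (\<Sum>b\<in>B. (sp b b * sp x b) *\<^sub>R b)" using B(5) that by blast
        then have "sp (y - ?d) x = sp (y - ?d) (\<Sum>b\<in>B. (sp b b * sp x b) *\<^sub>R b)" by simp
        also have "\<dots> = (\<Sum>b\<in>B. (sp b b * sp x b) * sp (y - ?d) b)"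
          by (simp only: linear_sum[OF lin(1)] linear_scale[OF lin(1)] real_scaleR_def)
        finally show ?thesis by (simp add: yb)
      qed
      then show "\<forall>x. br x (y - ?d) = 0" using cent by blast
    qed
    have br_D: "\<exists>d\<in>?D. \<exists>e\<in>?D. br x y = br d e" for x y
    proof -
      obtain d e where d: "d \<in> ?D" "\<And>z. br z (x - d) = 0" and e: "e \<in> ?D" "\<And>z. br z (y - e) = 0"
        using split by metis
      have "br x y = br x e" using e(2)[of x] by (simp add: br_simps)
      also have "\<dots> = br d e" using d(2)[of e] br_anti[of x e] br_anti[of d e] by (simp add: br_simps)
      finally show ?thesis using d(1) e(1) by blast
    qed
    have D_sub: "?D \<subseteq> derived_series br (Suc k)" for k
    proof (induction k)
      case (Suc k)
      have "br x y \<in> derived_series br (Suc (Suc k))" for x y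
      proof -
        obtain d e where "d \<in> ?D" "e \<in> ?D" "br x y = br d e" using br_D by blast
        then show ?thesis using Suc.IH unfolding derived_series.simps(2)[of br "Suc k"] by (blast intro: span_base)
      qed
      then have "span {br x y |x y. x \<in> UNIV \<and> y \<in> UNIV} \<subseteq> derived_series br (Suc (Suc k))"
        by (intro span_minimal ideal_subspace ideal_derived_series) blast
      then show ?case by simp
    qed simp
    obtain k where k: "derived_series br k = {0}" using solv by (auto simp: solvable_lie_def)
    \<comment> \<open>One term beyond \<open>k\<close>, because \<open>D_sub\<close> starts at index
      1.\<close>
    have "derived_series br (Suc k) = {0}" using k by (auto simp: br_simps)
    then have "?D \<subseteq> {0}" using D_sub[of k] by simp
    then have "br x y = 0" for x y using brD by blast
    then have "lower_central br UNIV (Suc 0) = {0}" by simp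
    then show False using not_nil unfolding nilpotent_lie_def nilpotent_sub_def by blast
  qed
  then show thesis using that cent by blast
qed

text \<open>The Ricci form vanishes on a central \<open>e\<close>, while \<open>sp e\<close> does
  not vanish identically; so the Einstein constant is zero, and with it the Killing form.\<close>

lemma einstein_trace:
  assumes "einstein br sp" and e: "e \<noteq> 0" "\<And>x. br x e = 0"
  shows "trace_map (\<lambda>x. br z (br y x)) = 0"
proof -
  obtain c where c: "\<And>y z. ricci br sp y z = c * sp y z" using assms by (auto simp: einstein_def)
  obtain w where "sp e w \<noteq> 0" using sp_nondeg e(1) by blast
  moreover have "br e x = 0" for x using e(2)[of x] br_anti[of e x] by simp
  then have "ricci br sp e w = 0" by (simp add: ricci_eq br_simps trace_map_zero)
  ultimately have "c = 0" using c by simp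
  then show ?thesis using c[of y z] by (simp add: ricci_eq)
qed

lemma derived_subset_nilradical:
  assumes "solvable_lie br"
  shows "derived_series br 1 \<subseteq> nilradical br"
  using nilpotent_derived[OF assms] ideal_derived_series unfolding nilradical_def
  by (blast intro: span_base)

lemma witt_index_ge:
  assumes "totally_isotropic sp S"
  shows "dim S \<le> witt_index sp"
proof -
  have "finite {dim V | V. totally_isotropic sp V}"
    by (rule finite_subset[of _ "{..DIM('a)}"]) (auto intro: dim_subset_UNIV)
  then show ?thesis unfolding witt_index_def using assms by (intro Max_ge) auto
qed

end

section \<open>The dimension count and the totally isotropic plane\<close>

theorem theorem1p2:
  fixes br :: "'a::euclidean_space \<Rightarrow> 'a \<Rightarrow> 'a"
    and sp :: "'a \<Rightarrow> 'a \<Rightarrow> real"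
  assumes "lie_algebra br"
    and "solvable_lie br"
    and "invariant_sp br sp"
    and "einstein br sp"
    and "\<not> nilpotent_lie br"
  shows "DIM('a) \<ge> 6 \<and> dim (nilradical br) \<ge> 5 \<and> witt_index sp \<ge> 2"
proof -
  interpret metric_lie br sp using assms by unfold_locales
  let ?D = "derived_series br 1"
  have D: "subspace ?D" by (rule ideal_subspace[OF ideal_derived_series])
  obtain e where e: "e \<noteq> 0" "e \<in> ?D" "\<And>x. br x e = 0"
    using derived_meets_center assms by blast
  obtain x where x: "\<And>n. \<exists>w. (br x ^^ n) w \<noteq> 0"
    using engel_solvable assms by blast
  have "scalar_product sp" using assms(3) by (simp add: invariant_sp_def)
  then obtain n where n: "n > 0" "dim (range (br x ^^ n)) \<ge> 4"
    "\<exists>v\<in>range (br x ^^ n). v \<noteq> 0 \<and> sp v v = 0"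
    "\<forall>v\<in>range (br x ^^ n). br x v = 0 \<longrightarrow> v = 0"
    by (rule skew_operator_trace_square_zero[of sp "br x", OF _ linear_br sp_br
          einstein_trace[OF assms(4) e(1,3)] x]) blast
  define V where "V = range (br x ^^ n)"
  note n = n[folded V_def]
  have subV: "subspace V" unfolding V_def
    by (rule linear_subspace_image[OF linear_funpow[OF linear_br] subspace_UNIV])
  \<comment> \<open>\<open>n\<close> is positive, so every element of \<open>V\<close> is a bracket
    with \<open>x\<close>.\<close>
  have VD: "V \<subseteq> ?D"
  proof -
    obtain m where "n = Suc m" using n(1) by (cases n) auto
    then show ?thesis by (auto simp: V_def intro: span_base)
  qed
  \<comment> \<open>\<open>br x\<close> is injective on \<open>V\<close> but kills the central
    \<open>e\<close>.\<close>
  have "e \<notin> V" using n(4) e(1,3) by blast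
  then have dim5: "dim (insert e V) \<ge> 5"
    using n(2) subV by (simp add: dim_insert span_eq_iff[THEN iffD2])
  also have "dim (insert e V) \<le> dim (nilradical br)"
    using VD e(2) derived_subset_nilradical[OF assms(2)] by (intro dim_subset) blast
  finally have nil: "dim (nilradical br) \<ge> 5" .
  \<comment> \<open>Otherwise some \<open>x - k *\<^sub>R e\<close> would be an element of
    \<open>V\<close> killed by \<open>br x\<close>, hence zero, and \<open>x\<close> would be
    central.\<close>
  have "x \<notin> span (insert e V)"
  proof
    assume "x \<in> span (insert e V)"
    then obtain k where "x - k *\<^sub>R e \<in> V"
      using subV by (auto simp: span_insert span_eq_iff[THEN iffD2])
    then have "x = k *\<^sub>R e" using n(4) e(3) by (force simp: br_simps)
    then have "br x w = 0" for w using e(3)[of w] br_anti[of e w] by (simp add: br_simps)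
    then show False using x[of 1] by simp
  qed
  then have "dim (insert x (insert e V)) \<ge> 6" using dim5 by (simp add: dim_insert[of x])
  moreover have "dim (insert x (insert e V)) \<le> DIM('a)" by (rule dim_subset_UNIV)
  moreover have "witt_index sp \<ge> 2"
  proof -
    obtain v where v: "v \<in> V" "v \<noteq> 0" "sp v v = 0" using n(3) by blast
    \<comment> \<open>Invariance makes a central element orthogonal to all brackets; both
      \<open>v\<close> and \<open>e\<close> itself lie in the derived algebra.\<close>
    have De: "sp d e = 0" if "d \<in> ?D" for d
    proof -
      have "sp d e = 0" if "d \<in> span {br x y | x y. x \<in> UNIV \<and> y \<in> UNIV}"
        using that
      proof (induction rule: span_induct)
        case base
        show ?case by (simp add: subspace_def sp_simps)
      next
        case (step d)
        then show ?case by (auto simp: sp_br e(3) sp_simps)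
      qed
      then show ?thesis using that by simp
    qed
    have "sp v e = 0" "sp e e = 0" using De VD v(1) e(2) by blast+
    then have ve: "sp x y = 0" if "x \<in> {e, v}" "y \<in> {e, v}" for x y
      using that v(3) sp_sym[of e v] by auto
    have ve': "sp x y = 0" if "x \<in> span {e, v}" "y \<in> {e, v}" for x y
      using that(1) by (rule span_induct) (use ve that(2) in \<open>auto simp: subspace_def sp_simps\<close>)
    have "sp x y = 0" if "x \<in> span {e, v}" "y \<in> span {e, v}" for x y
      using that(2) by (rule span_induct) (use ve' that(1) in \<open>auto simp: subspace_def sp_simps\<close>)
    then have "totally_isotropic sp (span {e, v})" by (simp add: totally_isotropic_def)
    then have "dim (span {e, v}) \<le> witt_index sp" by (rule witt_index_ge)
    moreover have "e \<notin> span {v}"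
      using \<open>e \<notin> V\<close> v(1) span_minimal[of "{v}" V] subV by auto
    then have "dim {e, v} = 2" using v(2) by (simp add: dim_insert)
    ultimately show ?thesis by simp
  qed
  ultimately show ?thesis using nil by linarith
qed

end
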